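(* Let $\nu>0$, $m,\kappa\in\mathbb R$ and $\beta>0$. Let $(F,\Phi)$, functions of $(r,z,t)$ with $r>0$, $z\in\mathbb R$, be a sufficiently smooth decaying solution of $$F_t+b_m[\Phi]\cdot\nabla F=\nu\Delta_5F+2\Phi_zF,\qquad \Phi=-\kappa\,\mathcal A^{-\beta}S,\qquad S=\partial_z(F^2),$$ where $b_m[\Phi]=(-r\Phi_z,\ m\Phi+r\Phi_r)$. Then $$\frac12\frac{d}{dt}\|F\|_{L^2(d\mu_5)}^2+\nu\|\nabla F\|_{L^2(d\mu_5)}^2=\frac{m\kappa}{2}\,\bigl\|\mathcal A^{-\beta/2}S\bigr\|_{L^2(d\mu_5)}^2 .$$
   Context: Notation: $\nabla=(\partial_r,\partial_z)$, $b\cdot\nabla F=b^rF_r+b^zF_z$, $\Delta_5=\partial_{rr}+\frac3r\partial_r+\partial_{zz}$, $d\mu_5=r^3\,dr\,dz$, $\mathcal A=-\Delta_5$. Functions of $(r,z)$ are identified with functions on $\mathbb R^5=\mathbb R^4\times\mathbb R$ radial in the first four variables, so that $\Delta_5$ is the Laplacian of $\mathbb R^5$ and $\mathcal A$ is a positive self-adjoint operator on $L^2(d\mu_5)$; its real powers are defined by functional calculus (Fourier multipliers $|\xi|^{2s}$ on $\mathbb R^5$). "Sufficiently smooth decaying" means: $F$ and $\Phi$ are smooth as functions on $\mathbb R^5$ (in particular regular at the axis $r=0$), all quantities in the statement are well defined and finite (in particular $\mathcal A^{-\beta/2}S\in L^2(d\mu_5)$ and $\langle\mathcal A^{-\beta}S,S\rangle_{L^2(d\mu_5)}=\|\mathcal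 A^{-\beta/2}S\|_{L^2(d\mu_5)}^2$), and the functions decay fast enough that differentiation under the integral and integration by parts produce no boundary terms at infinity or at $r=0$. *)

theory Defs
  imports "HOL-Analysis.Analysis"
begin

(* A scalar field is written f r z; only its values for r > 0 are meaningful.
   Time-dependent fields take the time first, so that F t is a scalar field. *)
type_synonym field2 = "real \<Rightarrow> real \<Rightarrow> real"

type_synonym R5 = "(real^4) \<times> real"


section \<open>Differential operators and norms in the variables (r, z)\<close>

definition D_r :: "field2 \<Rightarrow> field2" where
  "D_r f = (\<lambda>r z. deriv (\<lambda>r'. f r' z) r)"

definition D_z :: "field2 \<Rightarrow> field2" where
  "D_z f = (\<lambda>r z. deriv (\<lambda>z'. f r z') z)"

definition Lap5 :: "field2 \<Rightarrow> field2" where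
  "Lap5 f = (\<lambda>r z. D_r (D_r f) r z + 3 / r * D_r f r z + D_z (D_z f) r z)"

definition drift_r :: "field2 \<Rightarrow> field2" where
  "drift_r \<phi> = (\<lambda>r z. - r * D_z \<phi> r z)"

definition drift_z :: "real \<Rightarrow> field2 \<Rightarrow> field2" where
  "drift_z m \<phi> = (\<lambda>r z. m * \<phi> r z + r * D_r \<phi> r z)"

definition advect :: "real \<Rightarrow> field2 \<Rightarrow> field2 \<Rightarrow> field2" where
  "advect m \<phi> f = (\<lambda>r z. drift_r \<phi> r z * D_r f r z + drift_z m \<phi> r z * D_z f r z)"

definition source :: "field2 \<Rightarrow> field2" where
  "source f = D_z (\<lambda>r z. (f r z)\<^sup>2)"

definition mu5 :: "(real \<times> real) measure" where
  "mu5 = density lborel (\<lambda>(r, z). ennreal (indicator {0<..} r * r ^ 3))"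

definition integrable5 :: "field2 \<Rightarrow> bool" where
  "integrable5 f \<longleftrightarrow> integrable mu5 (\<lambda>(r, z). f r z)"

definition integral5 :: "field2 \<Rightarrow> real" where
  "integral5 f = (LINT p|mu5. (case p of (r, z) \<Rightarrow> f r z))"

definition L2norm5 :: "field2 \<Rightarrow> real" where
  "L2norm5 f = sqrt (integral5 (\<lambda>r z. (f r z)\<^sup>2))"

(* The norm on real \<times> real is the Euclidean one. *)
definition L2norm_grad5 :: "field2 \<Rightarrow> real" where
  "L2norm_grad5 f = L2norm5 (\<lambda>r z. norm (D_r f r z, D_z f r z))"


section \<open>Smooth functions, Schwartz functions and Fourier multipliers\<close>

fun iter_deriv :: "'a list \<Rightarrow> ('a::euclidean_space \<Rightarrow> 'b::real_normed_vector) \<Rightarrow> 'a \<Rightarrow> 'b" where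
  "iter_deriv [] f = f"
| "iter_deriv (v # vs) f = (\<lambda>x. frechet_derivative (iter_deriv vs f) (at x) v)"

(* C^infinity: all iterated partial derivatives exist and are Frechet differentiable. *)
definition smooth :: "('a::euclidean_space \<Rightarrow> 'b::real_normed_vector) \<Rightarrow> bool" where
  "smooth f \<longleftrightarrow> (\<forall>vs. set vs \<subseteq> Basis \<longrightarrow> (iter_deriv vs f) differentiable_on UNIV)"

definition schwartz :: "('a::euclidean_space \<Rightarrow> complex) \<Rightarrow> bool" where
  "schwartz \<phi> \<longleftrightarrow> smooth \<phi> \<and>
     (\<forall>vs (N::nat). set vs \<subseteq> Basis \<longrightarrow>
        bounded (range (\<lambda>x. (1 + norm x) ^ N *\<^sub>R iter_deriv vs \<phi> x)))"

definition fourier :: "('a::euclidean_space \<Rightarrow> complex) \<Rightarrow> 'a \<Rightarrow> complex" where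
  "fourier \<phi> \<xi> = (LINT x|lborel. cis (- (\<xi> \<bullet> x)) * \<phi> x)"

definition tempered :: "('a::euclidean_space \<Rightarrow> complex) \<Rightarrow> bool" where
  "tempered f \<longleftrightarrow> (\<exists>N::nat. integrable lborel (\<lambda>x. f x / (1 + norm x) ^ N))"

(* h is the Fourier transform of f as a tempered distribution. For f in L^1 this is the
   usual integral and for f in L^2 the Plancherel transform (both up to null sets). *)
definition has_fourier :: "('a::euclidean_space \<Rightarrow> complex) \<Rightarrow> ('a \<Rightarrow> complex) \<Rightarrow> bool" where
  "has_fourier f h \<longleftrightarrow> tempered f \<and> tempered h \<and>
     (\<forall>\<phi>. schwartz \<phi> \<longrightarrow>
        (LINT x|lborel. f x * fourier \<phi> x) = (LINT \<xi>|lborel. h \<xi> * \<phi> \<xi>))"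

definition lift5 :: "field2 \<Rightarrow> R5 \<Rightarrow> real" where
  "lift5 f = (\<lambda>(y, z). f (norm y) z)"

(* g = A^s f for A = - Delta_5, with Fourier multiplier |xi|^(2 s) on R^5. Both f and g
   matter only up to null sets. For f and g in L^2 this is the functional calculus of the
   self-adjoint operator A; membership in L^2 is not part of the definition. *)
definition has_A_power :: "real \<Rightarrow> field2 \<Rightarrow> field2 \<Rightarrow> bool" where
  "has_A_power s f g \<longleftrightarrow>
     (\<exists>h. has_fourier (\<lambda>x. complex_of_real (lift5 f x)) h \<and>
          has_fourier (\<lambda>x. complex_of_real (lift5 g x))
                      (\<lambda>\<xi>. complex_of_real (norm \<xi> powr (2 * s)) * h \<xi>))"

(* The field on r > 0 is (after extension to the axis) a smooth function on R^5. *)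
definition smooth5 :: "field2 \<Rightarrow> bool" where
  "smooth5 f \<longleftrightarrow>
     (\<exists>G :: R5 \<Rightarrow> real. smooth G \<and> (\<forall>y z. y \<noteq> 0 \<longrightarrow> G (y, z) = f (norm y) z))"


section \<open>Solutions\<close>

definition solves :: "real \<Rightarrow> real \<Rightarrow> real set \<Rightarrow> (real \<Rightarrow> field2) \<Rightarrow> (real \<Rightarrow> field2) \<Rightarrow> bool" where
  "solves \<nu> m I F \<Phi> \<longleftrightarrow>
     (\<forall>t\<in>I. \<forall>r>0. \<forall>z.
        (\<lambda>s. F s r z) differentiable (at t) \<and>
        deriv (\<lambda>s. F s r z) t + advect m (\<Phi> t) (F t) r z
          = \<nu> * Lap5 (F t) r z + 2 * D_z (\<Phi> t) r z * F t r z)"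

(* Locally uniform domination of d/dt (F^2 / 2), which allows differentiation of the
   L^2 norm under the integral. *)
definition time_dominated :: "real set \<Rightarrow> (real \<Rightarrow> field2) \<Rightarrow> bool" where
  "time_dominated I F \<longleftrightarrow>
     (\<forall>t\<in>I. \<exists>\<delta>>0. \<exists>w. integrable5 w \<and>
        (\<forall>s\<in>I. \<bar>s - t\<bar> < \<delta> \<longrightarrow>
           (\<forall>r>0. \<forall>z. \<bar>F s r z * deriv (\<lambda>s'. F s' r z) s\<bar> \<le> w r z)))"

(* Spatial decay: absolute convergence of the energy, of the dissipation, of the two cubic
   terms of the energy balance, and of every term of the fluxes b F^2 and Phi F^2. *)
definition space_decaying :: "real \<Rightarrow> field2 \<Rightarrow> field2 \<Rightarrow> bool" where
  "space_decaying m f \<phi> \<longleftrightarrow>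
     integrable5 (\<lambda>r z. (f r z)\<^sup>2) \<and>
     integrable5 (\<lambda>r z. (D_r f r z)\<^sup>2) \<and>
     integrable5 (\<lambda>r z. (D_z f r z)\<^sup>2) \<and>
     integrable5 (\<lambda>r z. f r z * advect m \<phi> f r z) \<and>
     integrable5 (\<lambda>r z. D_z \<phi> r z * (f r z)\<^sup>2) \<and>
     integrable5 (\<lambda>r z. \<phi> r z * (f r z)\<^sup>2) \<and>
     integrable5 (\<lambda>r z. r * D_r \<phi> r z * (f r z)\<^sup>2) \<and>
     integrable5 (\<lambda>r z. r * D_z \<phi> r z * (f r z)\<^sup>2)"

definition smooth_decaying ::
    "real \<Rightarrow> real set \<Rightarrow> (real \<Rightarrow> field2) \<Rightarrow> (real \<Rightarrow> field2) \<Rightarrow> bool" where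
  "smooth_decaying m I F \<Phi> \<longleftrightarrow>
     (\<forall>t\<in>I. smooth5 (F t) \<and> smooth5 (\<Phi> t) \<and> space_decaying m (F t) (\<Phi> t)) \<and>
     time_dominated I F"

end

theory Submission
  imports Defs
begin

text \<open>
  Multiply the equation by \<open>F\<close> and integrate against \<open>r\<^sup>3 dr dz\<close>. In these variables the
  divergence of a field \<open>(u, v)\<close> is \<open>u\<^sub>r + 3 u / r + v\<^sub>z\<close>, and three exact divergences settle the
  spatial part.

  \<^item> The drift \<open>b = (- r \<Phi>\<^sub>z, m \<Phi> + r \<Phi>\<^sub>r)\<close> has divergence \<open>(m - 4) \<Phi>\<^sub>z\<close>: the radial part contributes
    \<open>- 4 \<Phi>\<^sub>z\<close>, and the mixed derivatives cancel. Hence the flux \<open>b F\<^sup>2\<close> gives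
    \<open>2 \<integral> F (b \<cdot> \<nabla>F) = (4 - m) \<integral> \<Phi>\<^sub>z F\<^sup>2\<close> (lemma \<open>integral5_advection\<close>).
  \<^item> The flux \<open>F \<nabla>F\<close> gives \<open>\<integral> F \<Delta>\<^sub>5 F = - \<integral> |\<nabla>F|\<^sup>2\<close> (lemma \<open>integral5_dissipation\<close>).
  \<^item> The flux \<open>(0, \<Phi> F\<^sup>2)\<close> gives \<open>\<integral> \<Phi> S = - \<integral> \<Phi>\<^sub>z F\<^sup>2\<close> (lemma \<open>integral5_source_pairing\<close>).

  Together with the stretching term, the coefficient of \<open>\<integral> \<Phi>\<^sub>z F\<^sup>2\<close> in the balance of \<open>\<parallel>F\<parallel>\<^sup>2 / 2\<close> is
  \<open>2 - (4 - m) / 2 = m / 2\<close>. Since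
  \<open>\<Phi> = - \<kappa> G\<close> with \<open>G\<close> the power \<open>- \<beta>\<close> of \<open>- \<Delta>\<^sub>5\<close> applied to \<open>S\<close>, the last identity turns this
  integral into \<open>\<kappa> \<integral> G S = \<kappa> \<parallel>P\<parallel>\<^sup>2\<close>, where \<open>P\<close> is obtained with half that power.

  Two analytic points remain. Boundary terms are absent although only absolute integrability of
  the fluxes is known: on the box \<open>[0, N] \<times> [- N, N]\<close> a product of quadratic cutoffs kills the outer
  boundary, the weight \<open>r\<^sup>3\<close> kills the axis, and dominated convergence removes the cutoff as
  \<open>N \<rightarrow> \<infinity>\<close> (lemma \<open>integral_divergence5_eq_0\<close>). The energy is differentiated under the integral by
  dominated convergence of difference quotients (lemma \<open>has_derivative_integral5_square\<close>).
\<close>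

section \<open>Planar representatives of axially symmetric smooth fields\<close>

lemma mixed_difference_mean_value:
  fixes g :: "real \<times> real \<Rightarrow> real"
  assumes r: "\<And>r z. ((\<lambda>r. g (r, z)) has_real_derivative gr (r, z)) (at r)"
    and rz: "\<And>r z. ((\<lambda>z. gr (r, z)) has_real_derivative grz (r, z)) (at z)"
    and "h > 0"
  obtains \<xi> \<eta> where "a < \<xi>" "\<xi> < a + h" "b < \<eta>" "\<eta> < b + h"
    "g (a + h, b + h) - g (a + h, b) - g (a, b + h) + g (a, b) = h * h * grz (\<xi>, \<eta>)"
proof -
  have "\<exists>\<xi>>a. \<xi> < a + h \<and> (g (a + h, b + h) - g (a + h, b)) - (g (a, b + h) - g (a, b))
      = (a + h - a) * (gr (\<xi>, b + h) - gr (\<xi>, b))"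
    using \<open>h > 0\<close> by (intro MVT2) (auto intro!: derivative_eq_intros r)
  then obtain \<xi> where \<xi>: "a < \<xi>" "\<xi> < a + h"
    "(g (a + h, b + h) - g (a + h, b)) - (g (a, b + h) - g (a, b)) = h * (gr (\<xi>, b + h) - gr (\<xi>, b))"
    by auto
  have "\<exists>\<eta>>b. \<eta> < b + h \<and> gr (\<xi>, b + h) - gr (\<xi>, b) = (b + h - b) * grz (\<xi>, \<eta>)"
    using \<open>h > 0\<close> by (intro MVT2) (auto intro!: rz)
  then obtain \<eta> where \<eta>: "b < \<eta>" "\<eta> < b + h" "gr (\<xi>, b + h) - gr (\<xi>, b) = h * grz (\<xi>, \<eta>)"
    by auto
  show ?thesis
    using \<xi> \<eta> by (intro that[of \<xi> \<eta>]) auto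
qed

text \<open>
  The second difference quotient over a small square equals a value of either mixed derivative at
  some point of the square; shrinking the square gives the equality by continuity.
\<close>

lemma mixed_partials_commute:
  fixes g :: "real \<times> real \<Rightarrow> real"
  assumes r: "\<And>r z. ((\<lambda>r. g (r, z)) has_real_derivative gr (r, z)) (at r)"
    and z: "\<And>r z. ((\<lambda>z. g (r, z)) has_real_derivative gz (r, z)) (at z)"
    and rz: "\<And>r z. ((\<lambda>z. gr (r, z)) has_real_derivative grz (r, z)) (at z)"
    and zr: "\<And>r z. ((\<lambda>r. gz (r, z)) has_real_derivative gzr (r, z)) (at r)"
    and cont: "continuous_on UNIV grz" "continuous_on UNIV gzr"
  shows "grz = gzr"
proof
  fix p :: "real \<times> real"
  obtain a b where p: "p = (a, b)" by fastforce
  define h where "h n = 1 / real (Suc n)" for n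
  have h: "h n > 0" for n by (simp add: h_def)
  have h0: "h \<longlonglongrightarrow> 0"
    unfolding h_def using LIMSEQ_inverse_real_of_nat by (simp add: inverse_eq_divide)
  let ?close = "\<lambda>n q. a < fst q \<and> fst q < a + h n \<and> b < snd q \<and> snd q < b + h n"
  have "\<exists>q q'. ?close n q \<and> ?close n q' \<and> grz q = gzr q'" for n
  proof -
    obtain \<xi> \<eta> where 1: "a < \<xi>" "\<xi> < a + h n" "b < \<eta>" "\<eta> < b + h n"
      "g (a + h n, b + h n) - g (a + h n, b) - g (a, b + h n) + g (a, b) = h n * h n * grz (\<xi>, \<eta>)"
      using mixed_difference_mean_value[of g gr grz "h n" a b, OF r rz h] .
    obtain \<eta>' \<xi>' where 2: "b < \<eta>'" "\<eta>' < b + h n" "a < \<xi>'" "\<xi>' < a + h n"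
      "g (a + h n, b + h n) - g (a, b + h n) - g (a + h n, b) + g (a, b) = h n * h n * gzr (\<xi>', \<eta>')"
      using mixed_difference_mean_value[of "\<lambda>(z, r). g (r, z)" "\<lambda>(z, r). gz (r, z)"
        "\<lambda>(z, r). gzr (r, z)" "h n" b a, unfolded prod.case, OF z zr h] .
    have "h n * h n * grz (\<xi>, \<eta>) = h n * h n * gzr (\<xi>', \<eta>')"
      using 1(5) 2(5) by linarith
    then have "grz (\<xi>, \<eta>) = gzr (\<xi>', \<eta>')"
      using h[of n] by simp
    with 1 2 show ?thesis
      by (intro exI[of _ "(\<xi>, \<eta>)"] exI[of _ "(\<xi>', \<eta>')"]) auto
  qed
  then obtain q q' where q: "\<And>n. ?close n (q n)" "\<And>n. ?close n (q' n)" "\<And>n. grz (q n) = gzr (q' n)"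
    by metis
  have lim: "s \<longlonglongrightarrow> p" if "\<And>n. ?close n (s n)" for s
  proof -
    have ub: "(\<lambda>n. c + h n) \<longlonglongrightarrow> c" for c
      using tendsto_add[OF tendsto_const h0, of c] by simp
    have "(\<lambda>n. fst (s n)) \<longlonglongrightarrow> a" "(\<lambda>n. snd (s n)) \<longlonglongrightarrow> b"
      by (rule tendsto_sandwich[OF _ _ tendsto_const ub], use that in \<open>auto intro!: always_eventually less_imp_le\<close>)+
    then have "(\<lambda>n. (fst (s n), snd (s n))) \<longlonglongrightarrow> (a, b)"
      by (rule tendsto_Pair)
    then show ?thesis by (simp add: p)
  qed
  have "isCont grz p" "isCont gzr p"
    using cont by (simp_all add: continuous_on_eq_continuous_at del: split_paired_All)
  then have "(\<lambda>n. grz (q n)) \<longlonglongrightarrow> grz p" "(\<lambda>n. gzr (q' n)) \<longlonglongrightarrow> gzr p"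
    using lim[of q] lim[of q'] q(1,2) by (auto intro: isCont_tendsto_compose)
  then show "grz p = gzr p"
    using q(3) by (auto intro: LIMSEQ_unique)
qed

text \<open>
  \<open>D_r\<close> and \<open>D_z\<close> at a point with \<open>r > 0\<close> see only values with \<open>r > 0\<close>. So a field may be replaced by
  any function that agrees with it there, whatever it does for \<open>r \<le> 0\<close>.
\<close>

lemma D_r_eqI:
  assumes "\<And>r. r > 0 \<Longrightarrow> f r z = g r" and "(g has_real_derivative d) (at r)" and "r > 0"
  shows "D_r f r z = d"
proof -
  have "((\<lambda>r'. f r' z) has_real_derivative d) (at r)"
    by (rule has_field_derivative_transform_within_open[OF assms(2), of "{0<..}"]) (use assms in auto)
  then show ?thesis unfolding D_r_def by (rule DERIV_imp_deriv)
qed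

lemma D_z_eqI:
  assumes "\<And>z. f r z = g z" and "(g has_real_derivative d) (at z)"
  shows "D_z f r z = d"
proof -
  have "(\<lambda>z'. f r z') = g" using assms(1) by auto
  with assms(2) show ?thesis unfolding D_z_def by (simp add: DERIV_imp_deriv)
qed

text \<open>
  Restricting the smooth function on \<open>\<real>\<^sup>5\<close> to the plane spanned by one horizontal unit vector and
  the vertical axis extends the field across \<open>r = 0\<close> to all of \<open>\<real>\<^sup>2\<close>. Every derivative in \<open>r\<close> and \<open>z\<close> is
  then continuous up to and beyond the axis, so the axis needs no separate treatment in the
  integrations by parts.
\<close>

lemma smooth5_planar_extension:
  assumes "smooth5 f"
  obtains g gr gz grr grz gzz :: "real \<times> real \<Rightarrow> real" where
    "continuous_on UNIV g" "continuous_on UNIV gr" "continuous_on UNIV gz"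
    "continuous_on UNIV grr" "continuous_on UNIV grz" "continuous_on UNIV gzz"
    "\<And>r z. ((\<lambda>r. g (r, z)) has_real_derivative gr (r, z)) (at r)"
    "\<And>r z. ((\<lambda>z. g (r, z)) has_real_derivative gz (r, z)) (at z)"
    "\<And>r z. ((\<lambda>r. gr (r, z)) has_real_derivative grr (r, z)) (at r)"
    "\<And>r z. ((\<lambda>z. gr (r, z)) has_real_derivative grz (r, z)) (at z)"
    "\<And>r z. ((\<lambda>r. gz (r, z)) has_real_derivative grz (r, z)) (at r)"
    "\<And>r z. ((\<lambda>z. gz (r, z)) has_real_derivative gzz (r, z)) (at z)"
    "\<And>r z. r > 0 \<Longrightarrow> f r z = g (r, z)"
    "\<And>r z. r > 0 \<Longrightarrow> D_r f r z = gr (r, z)"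
    "\<And>r z. r > 0 \<Longrightarrow> D_z f r z = gz (r, z)"
    "\<And>r z. r > 0 \<Longrightarrow> D_r (D_r f) r z = grr (r, z)"
    "\<And>r z. r > 0 \<Longrightarrow> D_z (D_z f) r z = gzz (r, z)"
proof -
  obtain G :: "R5 \<Rightarrow> real" where G: "smooth G" "\<And>y z. y \<noteq> 0 \<Longrightarrow> G (y, z) = f (norm y) z"
    using assms unfolding smooth5_def by auto
  define e :: "real^4" where "e = axis 1 1"
  have e: "norm e = 1" "e \<noteq> 0" "e \<in> Basis"
    by (simp_all add: e_def)
  define er ez :: R5 where "er = (e, 0)" and "ez = (0, 1)"
  have B: "er \<in> Basis" "ez \<in> Basis"
    using e by (simp_all add: er_def ez_def Basis_prod_def)
  define X where "X vs p = iter_deriv vs G (fst p *\<^sub>R e, snd p)" for vs and p :: "real \<times> real"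
  have diff: "iter_deriv vs G differentiable (at x)" if "set vs \<subseteq> Basis" for vs x
    using G(1) that unfolding smooth_def differentiable_on_def by blast
  have cont: "continuous_on UNIV (X vs)" if "set vs \<subseteq> Basis" for vs
  proof -
    have "continuous_on UNIV (iter_deriv vs G)"
      using diff[OF that] by (intro differentiable_imp_continuous_on) (auto simp: differentiable_on_def)
    moreover have "continuous_on UNIV (\<lambda>p :: real \<times> real. (fst p *\<^sub>R e, snd p))"
      by (intro continuous_intros)
    ultimately show ?thesis
      unfolding X_def by (rule continuous_on_compose2) simp
  qed
  have chain: "((\<lambda>s. iter_deriv vs G (c s)) has_real_derivative iter_deriv (v # vs) G (c x)) (at x)"
    if vs: "set vs \<subseteq> Basis" and c: "(c has_derivative (\<lambda>h. h *\<^sub>R v)) (at x)" for vs c v x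
  proof -
    let ?D = "frechet_derivative (iter_deriv vs G) (at (c x))"
    have D: "(iter_deriv vs G has_derivative ?D) (at (c x))"
      using diff[OF vs] frechet_derivative_works by blast
    have "((\<lambda>s. iter_deriv vs G (c s)) has_derivative (\<lambda>h. ?D (h *\<^sub>R v))) (at x)"
      by (rule has_derivative_compose[OF c D])
    moreover have "?D (h *\<^sub>R v) = h * ?D v" for h
      using D by (simp add: has_derivative_linear linear_cmul)
    ultimately show ?thesis
      by (auto intro: has_derivative_imp_has_field_derivative)
  qed
  have dr: "((\<lambda>r. X vs (r, z)) has_real_derivative X (er # vs) (r, z)) (at r)" if "set vs \<subseteq> Basis" for vs r z
    unfolding X_def fst_conv snd_conv
    by (rule chain[OF that]) (auto intro!: derivative_eq_intros simp: er_def)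
  have dz: "((\<lambda>z. X vs (r, z)) has_real_derivative X (ez # vs) (r, z)) (at z)" if "set vs \<subseteq> Basis" for vs r z
    unfolding X_def fst_conv snd_conv
    by (rule chain[OF that]) (auto intro!: derivative_eq_intros simp: ez_def)
  have mixed: "X [ez, er] = X [er, ez]"
    by (rule mixed_partials_commute[of "X []" "X [er]" "X [ez]"]) (use B in \<open>auto intro!: dr dz cont\<close>)
  have f: "f r z = X [] (r, z)" if "r > 0" for r z
    using G(2)[of "r *\<^sub>R e" z] that e by (simp add: X_def)
  have fr: "D_r f r z = X [er] (r, z)" if "r > 0" for r z
    by (rule D_r_eqI[of f z "\<lambda>r. X [] (r, z)"]) (use f that dr[of "[]"] in auto)
  have fz: "D_z f r z = X [ez] (r, z)" if "r > 0" for r z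
    by (rule D_z_eqI[of f r "\<lambda>z. X [] (r, z)"]) (use f that dz[of "[]"] in auto)
  have frr: "D_r (D_r f) r z = X [er, er] (r, z)" if "r > 0" for r z
    by (rule D_r_eqI[of "D_r f" z "\<lambda>r. X [er] (r, z)"]) (use fr that dr[of "[er]"] B in auto)
  have fzz: "D_z (D_z f) r z = X [ez, ez] (r, z)" if "r > 0" for r z
    by (rule D_z_eqI[of "D_z f" r "\<lambda>z. X [ez] (r, z)"]) (use fz that dz[of "[ez]"] B in auto)
  show ?thesis
    by (rule that[of "X []" "X [er]" "X [ez]" "X [er, er]" "X [er, ez]" "X [ez, ez]"])
      (use B dz[of "[er]"] f fr fz frr fzz mixed in \<open>auto intro!: dr dz cont\<close>)
qed

section \<open>The measure \<open>r\<^sup>3 dr dz\<close>\<close>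

definition weight5 :: "real \<times> real \<Rightarrow> real" where
  "weight5 p = indicator {0<..} (fst p) * fst p ^ 3"

lemma weight5_nonneg: "weight5 p \<ge> 0"
  by (auto simp: weight5_def indicator_def)

lemma borel_measurable_weight5 [measurable]: "weight5 \<in> borel_measurable borel"
  unfolding weight5_def borel_prod[symmetric] by measurable

lemma mu5_eq_density: "mu5 = density lborel (\<lambda>p. ennreal (weight5 p))"
  unfolding mu5_def weight5_def by (simp add: split_beta')

lemma sets_mu5 [measurable_cong, simp]: "sets mu5 = sets borel"
  by (simp add: mu5_eq_density)

lemma AE_mu5_pos: "AE p in mu5. fst p > 0"
proof -
  have "(\<lambda>p. ennreal (weight5 p)) \<in> borel_measurable lborel" by measurable
  then show ?thesis
    unfolding mu5_eq_density by (simp add: AE_density) (auto simp: weight5_def indicator_def)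
qed

lemma integral_mu5:
  fixes f :: "real \<times> real \<Rightarrow> real"
  assumes "f \<in> borel_measurable borel"
  shows "integral\<^sup>L mu5 f = (LINT p|lborel. weight5 p * f p)"
  unfolding mu5_eq_density using assms by (subst integral_density) (simp_all add: weight5_nonneg)

text \<open>
  The values of a field for \<open>r \<le> 0\<close> are arbitrary and may even be non-measurable, and an integral of
  a non-measurable function is \<open>0\<close> by convention. Measurability of both sides is therefore
  secured before a field is replaced by its planar representative.
\<close>

lemma integrable5_transfer:
  fixes f :: field2 and g :: "real \<times> real \<Rightarrow> real"
  assumes "integrable5 f" and "g \<in> borel_measurable borel" and "\<And>r z. r > 0 \<Longrightarrow> f r z = g (r, z)"
  shows "integrable mu5 g" and "integral5 f = integral\<^sup>L mu5 g"
proof -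
  have AE: "AE p in mu5. (case p of (r, z) \<Rightarrow> f r z) = g p"
    using AE_mu5_pos by eventually_elim (use assms(3) in \<open>auto simp: split_paired_all\<close>)
  have int: "integrable mu5 (\<lambda>(r, z). f r z)"
    using assms(1) by (simp add: integrable5_def)
  have m: "(\<lambda>(r, z). f r z) \<in> borel_measurable mu5" "g \<in> borel_measurable mu5"
    using assms(2) int by (auto cong: measurable_cong_sets)
  show "integrable mu5 g"
    using integrable_cong_AE[OF m AE] int by simp
  show "integral5 f = integral\<^sup>L mu5 g"
    unfolding integral5_def by (rule integral_cong_AE[OF m AE])
qed

section \<open>The divergence theorem without boundary terms\<close>

lemma box_integral_r_derivative_eq_0:
  fixes H dH :: "real \<times> real \<Rightarrow> real"
  assumes "a \<le> b" and cont: "continuous_on UNIV dH"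
    and deriv: "\<And>r z. ((\<lambda>r. H (r, z)) has_real_derivative dH (r, z)) (at r)"
    and "\<And>z. H (a, z) = 0" "\<And>z. H (b, z) = 0"
  shows "integrable lborel (\<lambda>p. indicator ({a..b} \<times> {c..d}) p * dH p)"
    and "(LINT p|lborel. indicator ({a..b} \<times> {c..d}) p * dH p) = 0"
proof -
  show int: "integrable lborel (\<lambda>p. indicator ({a..b} \<times> {c..d}) p * dH p)"
    using borel_integrable_compact[of "{a..b} \<times> {c..d}" dH] cont
    by (auto intro: compact_Times continuous_on_subset)
  have "(LINT p|lborel. indicator ({a..b} \<times> {c..d}) p * dH p)
      = (LINT z|lborel. LINT r|lborel. indicator ({a..b} \<times> {c..d}) (r, z) * dH (r, z))"
    using lborel_pair.integral_snd[of "\<lambda>r z. indicator ({a..b} \<times> {c..d}) (r, z) * dH (r, z)"] int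
    by (simp add: lborel_prod split_beta')
  also have "\<dots> = (LINT z|(lborel :: real measure). 0)"
  proof (rule Bochner_Integration.integral_cong[OF refl])
    fix z :: real
    have "continuous_on UNIV (\<lambda>r. dH (r, z))"
      by (rule continuous_on_compose2[OF cont]; (intro continuous_intros)?; simp)
    then have "isCont (\<lambda>r. dH (r, z)) r" for r
      by (simp add: continuous_on_eq_continuous_at)
    then have "(LINT r|lborel. dH (r, z) * indicator {a..b} r) = H (b, z) - H (a, z)"
      using assms(1) by (intro integral_FTC_Icc_real) (auto intro: deriv)
    moreover have "(LINT r|lborel. indicator ({a..b} \<times> {c..d}) (r, z) * dH (r, z))
      = (LINT r|lborel. indicator {c..d} z * (dH (r, z) * indicator {a..b} r))"
      by (auto intro!: Bochner_Integration.integral_cong simp: indicator_def)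
    ultimately show "(LINT r|lborel. indicator ({a..b} \<times> {c..d}) (r, z) * dH (r, z)) = 0"
      using assms(4,5) by simp
  qed
  finally show "(LINT p|lborel. indicator ({a..b} \<times> {c..d}) p * dH p) = 0" by simp
qed

lemma box_integral_z_derivative_eq_0:
  fixes H dH :: "real \<times> real \<Rightarrow> real"
  assumes "c \<le> d" and cont: "continuous_on UNIV dH"
    and deriv: "\<And>r z. ((\<lambda>z. H (r, z)) has_real_derivative dH (r, z)) (at z)"
    and "\<And>r. H (r, c) = 0" "\<And>r. H (r, d) = 0"
  shows "integrable lborel (\<lambda>p. indicator ({a..b} \<times> {c..d}) p * dH p)"
    and "(LINT p|lborel. indicator ({a..b} \<times> {c..d}) p * dH p) = 0"
proof -
  show int: "integrable lborel (\<lambda>p. indicator ({a..b} \<times> {c..d}) p * dH p)"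
    using borel_integrable_compact[of "{a..b} \<times> {c..d}" dH] cont
    by (auto intro: compact_Times continuous_on_subset)
  have "(LINT p|lborel. indicator ({a..b} \<times> {c..d}) p * dH p)
      = (LINT r|lborel. LINT z|lborel. indicator ({a..b} \<times> {c..d}) (r, z) * dH (r, z))"
    using lborel_pair.integral_fst'[unfolded lborel_prod, OF int] by (rule sym)
  also have "\<dots> = (LINT r|(lborel :: real measure). 0)"
  proof (rule Bochner_Integration.integral_cong[OF refl])
    fix r :: real
    have "continuous_on UNIV (\<lambda>z. dH (r, z))"
      by (rule continuous_on_compose2[OF cont]; (intro continuous_intros)?; simp)
    then have "isCont (\<lambda>z. dH (r, z)) z" for z
      by (simp add: continuous_on_eq_continuous_at)
    then have "(LINT z|lborel. dH (r, z) * indicator {c..d} z) = H (r, d) - H (r, c)"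
      using assms(1) by (intro integral_FTC_Icc_real) (auto intro: deriv)
    moreover have "(LINT z|lborel. indicator ({a..b} \<times> {c..d}) (r, z) * dH (r, z))
      = (LINT z|lborel. indicator {a..b} r * (dH (r, z) * indicator {c..d} z))"
      by (auto intro!: Bochner_Integration.integral_cong simp: indicator_def)
    ultimately show "(LINT z|lborel. indicator ({a..b} \<times> {c..d}) (r, z) * dH (r, z)) = 0"
      using assms(4,5) by simp
  qed
  finally show "(LINT p|lborel. indicator ({a..b} \<times> {c..d}) p * dH p) = 0" by simp
qed

text \<open>
  With the cutoff \<open>\<theta>(x) = 1 - (x / N)\<^sup>2\<close>, the field \<open>r\<^sup>3 \<theta>(r) \<theta>(z) (u, v)\<close> vanishes normally on all four
  sides of the box \<open>[0, N] \<times> [- N, N]\<close>, so its divergence has integral zero over the box. In terms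
  of \<open>\<mu>\<^sub>5\<close> the integrand is \<open>\<theta> \<theta> D\<close> plus terms with a factor \<open>\<theta>'\<close>; it converges to \<open>D\<close> and is
  dominated by \<open>|D| + 2 |u| + 2 |v|\<close>, since \<open>|\<theta>| \<le> 1\<close> and \<open>|\<theta>'| \<le> 2 / N\<close> on the box. The function \<open>D\<close>
  stands for the divergence on \<open>r > 0\<close>. Only its integrability as a whole is assumed, because
  the single terms \<open>u\<^sub>r\<close>, \<open>3 u / r\<close>, \<open>v\<^sub>z\<close> need not be integrable.
\<close>

lemma integral_divergence5_eq_0:
  fixes u v ur vz D :: "real \<times> real \<Rightarrow> real"
  assumes cont: "continuous_on UNIV u" "continuous_on UNIV v" "continuous_on UNIV ur" "continuous_on UNIV vz"
    and ur: "\<And>r z. ((\<lambda>r. u (r, z)) has_real_derivative ur (r, z)) (at r)"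
    and vz: "\<And>r z. ((\<lambda>z. v (r, z)) has_real_derivative vz (r, z)) (at z)"
    and int: "integrable mu5 u" "integrable mu5 v" "integrable mu5 D"
    and D: "\<And>r z. r > 0 \<Longrightarrow> D (r, z) = ur (r, z) + 3 / r * u (r, z) + vz (r, z)"
  shows "integral\<^sup>L mu5 D = 0"
proof -
  \<comment> \<open>The box has size \<open>N = Suc n\<close>, and \<open>s n = 1 / N\<close>.\<close>
  define s where "s n = 1 / real (Suc n)" for n
  have s: "s n > 0" "s n \<le> 1" for n by (auto simp: s_def)
  have s0: "s \<longlonglongrightarrow> 0"
    unfolding s_def using LIMSEQ_inverse_real_of_nat by (simp add: inverse_eq_divide)
  define \<theta> where "\<theta> n x = 1 - (x * s n)\<^sup>2" for n and x :: real
  define \<theta>' where "\<theta>' n x = - 2 * x * (s n)\<^sup>2" for n and x :: real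
  have d\<theta>: "(\<theta> n has_real_derivative \<theta>' n x) (at x)" for n x
    unfolding \<theta>_def \<theta>'_def by (auto intro!: derivative_eq_intros simp: power2_eq_square)
  have end0: "\<theta> n (real (Suc n)) = 0" "\<theta> n (- real (Suc n)) = 0" for n
    by (simp_all add: \<theta>_def s_def del: of_nat_Suc)
  define Q where "Q n = {0..real (Suc n)} \<times> {- real (Suc n)..real (Suc n)}" for n
  have \<theta>bound: "\<bar>\<theta> n x\<bar> \<le> 1 \<and> \<bar>\<theta>' n x\<bar> \<le> 2" if "\<bar>x\<bar> \<le> real (Suc n)" for n x
  proof -
    have 1: "\<bar>x * s n\<bar> \<le> 1"
      using that by (simp add: s_def abs_mult divide_le_eq)
    then have "(x * s n)\<^sup>2 \<le> 1" by (simp add: abs_square_le_1)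
    moreover have "\<bar>x * s n\<bar> * s n \<le> 1 * 1"
      using 1 s[of n] by (intro mult_mono) auto
    moreover have "\<bar>\<theta>' n x\<bar> = 2 * (\<bar>x * s n\<bar> * s n)"
      using s[of n] by (simp add: \<theta>'_def abs_mult power2_eq_square)
    ultimately show ?thesis by (auto simp: \<theta>_def)
  qed
  define Hr where "Hr n p = \<theta> n (fst p) * \<theta> n (snd p) * fst p ^ 3 * u p" for n p
  define Hz where "Hz n p = \<theta> n (fst p) * \<theta> n (snd p) * fst p ^ 3 * v p" for n p
  define dHr where "dHr n p = \<theta> n (snd p) * (\<theta>' n (fst p) * fst p ^ 3 * u p
    + \<theta> n (fst p) * (3 * (fst p)\<^sup>2 * u p + fst p ^ 3 * ur p))" for n p
  define dHz where "dHz n p = \<theta> n (fst p) * fst p ^ 3 * (\<theta>' n (snd p) * v p + \<theta> n (snd p) * vz p)" for n p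
  have c\<theta>: "continuous_on UNIV (\<lambda>p. \<theta> n (g p))" "continuous_on UNIV (\<lambda>p. \<theta>' n (g p))"
    if "continuous_on UNIV g" for n and g :: "real \<times> real \<Rightarrow> real"
    unfolding \<theta>_def \<theta>'_def using that by (auto intro!: continuous_intros)
  have cH: "continuous_on UNIV (dHr n)" "continuous_on UNIV (dHz n)" for n
    unfolding dHr_def dHz_def by (auto intro!: continuous_intros cont c\<theta>)
  have dH: "((\<lambda>r. Hr n (r, z)) has_real_derivative dHr n (r, z)) (at r)"
      "((\<lambda>z. Hz n (r, z)) has_real_derivative dHz n (r, z)) (at z)" for n r z
    unfolding Hr_def Hz_def dHr_def dHz_def fst_conv snd_conv
    by (auto intro!: derivative_eq_intros d\<theta> ur vz simp: algebra_simps power2_eq_square)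
  have r0: "integrable lborel (\<lambda>p. indicator (Q n) p * dHr n p)"
      "(LINT p|lborel. indicator (Q n) p * dHr n p) = 0" for n
    unfolding Q_def
    subgoal by (rule box_integral_r_derivative_eq_0(1)[OF _ cH(1) dH(1)]; simp add: Hr_def end0 del: of_nat_Suc)
    subgoal by (rule box_integral_r_derivative_eq_0(2)[OF _ cH(1) dH(1)]; simp add: Hr_def end0 del: of_nat_Suc)
    done
  have z0: "integrable lborel (\<lambda>p. indicator (Q n) p * dHz n p)"
      "(LINT p|lborel. indicator (Q n) p * dHz n p) = 0" for n
    unfolding Q_def
    subgoal by (rule box_integral_z_derivative_eq_0(1)[OF _ cH(2) dH(2)]; simp add: Hz_def end0 del: of_nat_Suc)
    subgoal by (rule box_integral_z_derivative_eq_0(2)[OF _ cH(2) dH(2)]; simp add: Hz_def end0 del: of_nat_Suc)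
    done
  \<comment> \<open>The divergence of the truncated field, with the weight \<open>r\<^sup>3\<close> divided out.\<close>
  define k where "k n p = indicator (Q n) p * (\<theta> n (fst p) * \<theta> n (snd p) * (ur p + 3 / fst p * u p + vz p)
    + \<theta>' n (fst p) * \<theta> n (snd p) * u p + \<theta> n (fst p) * \<theta>' n (snd p) * v p)" for n p
  have [measurable]: "u \<in> borel_measurable borel" "v \<in> borel_measurable borel"
     "ur \<in> borel_measurable borel" "vz \<in> borel_measurable borel"
    using cont by (auto intro: borel_measurable_continuous_onI)
  have [measurable]: "\<theta> n \<in> borel_measurable borel" "\<theta>' n \<in> borel_measurable borel" for n
    unfolding \<theta>_def \<theta>'_def by measurable
  have [measurable]: "fst \<in> borel_measurable (borel :: (real \<times> real) measure)"
    "snd \<in> borel_measurable (borel :: (real \<times> real) measure)"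
    by (auto intro!: borel_measurable_continuous_onI continuous_intros)
  have [measurable]: "Q n \<in> sets borel" for n
    unfolding Q_def by (intro borel_closed closed_Times) auto
  have [measurable]: "k n \<in> borel_measurable borel" for n
    unfolding k_def by measurable
  have "integral\<^sup>L mu5 (k n) = 0" for n
  proof -
    have "weight5 p * k n p = indicator (Q n) p * dHr n p + indicator (Q n) p * dHz n p" for p
    proof (cases "fst p > 0")
      case True
      then show ?thesis
        by (simp add: weight5_def k_def dHr_def dHz_def indicator_def field_simps power2_eq_square power3_eq_cube)
    next
      case False
      \<comment> \<open>On the axis both divergences vanish through the factors \<open>r\<^sup>2\<close> and \<open>r\<^sup>3\<close>.\<close>
      then show ?thesis
        by (cases "fst p = 0") (auto simp: weight5_def Q_def dHr_def dHz_def indicator_def)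
    qed
    then show ?thesis
      using r0[of n] z0[of n] by (simp add: integral_mu5)
  qed
  moreover have "(\<lambda>n. integral\<^sup>L mu5 (k n)) \<longlonglongrightarrow> integral\<^sup>L mu5 D"
  proof (rule integral_dominated_convergence)
    show "integrable mu5 (\<lambda>p. \<bar>D p\<bar> + 2 * \<bar>u p\<bar> + 2 * \<bar>v p\<bar>)"
      using int by auto
    show "AE p in mu5. (\<lambda>n. k n p) \<longlonglongrightarrow> D p"
      using AE_mu5_pos
    proof eventually_elim
      case (elim p)
      obtain N :: nat where N: "\<bar>fst p\<bar> + \<bar>snd p\<bar> \<le> real N"
        using real_arch_simple by blast
      have "p \<in> Q n" if "n \<ge> N" for n
      proof -
        have "real N \<le> real n" using that by simp
        with N elim show ?thesis unfolding Q_def by (auto simp: mem_Times_iff)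
      qed
      then have "\<forall>\<^sub>F n in sequentially. indicator (Q n) p = (1::real)"
        by (auto simp: eventually_sequentially intro!: exI[of _ N])
      then have i: "(\<lambda>n. indicator (Q n) p :: real) \<longlonglongrightarrow> 1"
        by (rule tendsto_eventually)
      have \<theta>1: "(\<lambda>n. \<theta> n x) \<longlonglongrightarrow> 1" for x
        unfolding \<theta>_def by (rule tendsto_eq_intros s0 | simp)+
      have \<theta>'0: "(\<lambda>n. \<theta>' n x) \<longlonglongrightarrow> 0" for x
        unfolding \<theta>'_def by (rule tendsto_eq_intros s0 | simp)+
      have Dp: "D p = 1 * (1 * 1 * (ur p + 3 / fst p * u p + vz p) + 0 * 1 * u p + 1 * 0 * v p)"
        using D[OF elim, of "snd p"] by simp
      show ?case
        unfolding k_def Dp by (intro tendsto_intros i \<theta>1 \<theta>'0)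
    qed
    show "AE p in mu5. norm (k n p) \<le> \<bar>D p\<bar> + 2 * \<bar>u p\<bar> + 2 * \<bar>v p\<bar>" for n
      using AE_mu5_pos
    proof eventually_elim
      case (elim p)
      have Dp: "ur p + 3 / fst p * u p + vz p = D p"
        using D[OF elim, of "snd p"] by simp
      show ?case
      proof (cases "p \<in> Q n")
        case True
        then have b: "\<bar>\<theta> n (fst p)\<bar> \<le> 1" "\<bar>\<theta>' n (fst p)\<bar> \<le> 2" "\<bar>\<theta> n (snd p)\<bar> \<le> 1" "\<bar>\<theta>' n (snd p)\<bar> \<le> 2"
          using \<theta>bound[of "fst p" n] \<theta>bound[of "snd p" n] by (auto simp: Q_def mem_Times_iff)
        have "\<bar>\<theta> n (fst p) * \<theta> n (snd p) * D p\<bar> \<le> 1 * 1 * \<bar>D p\<bar>"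
             "\<bar>\<theta>' n (fst p) * \<theta> n (snd p) * u p\<bar> \<le> 2 * 1 * \<bar>u p\<bar>"
             "\<bar>\<theta> n (fst p) * \<theta>' n (snd p) * v p\<bar> \<le> 1 * 2 * \<bar>v p\<bar>"
          unfolding abs_mult by (intro mult_mono b; simp)+
        then have "\<bar>\<theta> n (fst p) * \<theta> n (snd p) * D p + \<theta>' n (fst p) * \<theta> n (snd p) * u p
            + \<theta> n (fst p) * \<theta>' n (snd p) * v p\<bar> \<le> \<bar>D p\<bar> + 2 * \<bar>u p\<bar> + 2 * \<bar>v p\<bar>"
          by linarith
        with True show ?thesis unfolding k_def Dp by simp
      qed (simp add: k_def)
    qed
  qed (use int in \<open>auto cong: measurable_cong_sets\<close>)
  ultimately show ?thesis
    by (simp add: LIMSEQ_const_iff)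
qed

section \<open>Differentiating the energy in time\<close>

text \<open>
  By the mean value inequality the difference quotients of \<open>F\<^sup>2\<close> at \<open>t\<close> are bounded by \<open>2 w\<close>, so the
  dominated convergence theorem applies along every sequence of times tending to \<open>t\<close>. The
  function \<open>g\<close> is a measurable stand-in for \<open>F F\<^sub>t\<close>, which is known only for \<open>r > 0\<close>.
\<close>

lemma has_derivative_integral5_square:
  fixes F :: "real \<Rightarrow> field2" and g :: "real \<times> real \<Rightarrow> real"
  assumes "open I" "t \<in> I" "\<delta> > 0"
    and diff: "\<And>s r z. s \<in> I \<Longrightarrow> r > 0 \<Longrightarrow> (\<lambda>s. F s r z) differentiable (at s)"
    and w: "integrable5 w"
    and dom: "\<And>s r z. s \<in> I \<Longrightarrow> \<bar>s - t\<bar> < \<delta> \<Longrightarrow> r > 0 \<Longrightarrow> \<bar>F s r z * deriv (\<lambda>s. F s r z) s\<bar> \<le> w r z"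
    and int: "\<And>s. s \<in> I \<Longrightarrow> integrable5 (\<lambda>r z. (F s r z)\<^sup>2)"
    and g: "g \<in> borel_measurable borel" "\<And>r z. r > 0 \<Longrightarrow> g (r, z) = F t r z * deriv (\<lambda>s. F s r z) t"
  shows "integrable mu5 g"
    and "((\<lambda>s. integral5 (\<lambda>r z. (F s r z)\<^sup>2)) has_real_derivative 2 * integral\<^sup>L mu5 g) (at t)"
proof -
  note [measurable] = g(1)
  have w': "integrable mu5 (\<lambda>p. w (fst p) (snd p))"
    using w by (simp add: integrable5_def split_beta')
  show "integrable mu5 g"
  proof (rule Bochner_Integration.integrable_bound[OF w'])
    show "AE p in mu5. norm (g p) \<le> norm (w (fst p) (snd p))"
      using AE_mu5_pos
    proof eventually_elim
      case (elim p)
      then show ?case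
        using g(2)[of "fst p" "snd p"] dom[of t "fst p" "snd p"] assms(2,3) by simp
    qed
  qed simp
  obtain \<epsilon> where \<epsilon>: "\<epsilon> > 0" "ball t \<epsilon> \<subseteq> I"
    using assms(1,2) openE by blast
  \<comment> \<open>A convex neighbourhood of \<open>t\<close> is needed for the mean value inequality.\<close>
  define S where "S = ball t (min \<epsilon> \<delta>)"
  have S: "open S" "convex S" "t \<in> S" "S \<subseteq> I" "\<And>s. s \<in> S \<Longrightarrow> \<bar>s - t\<bar> < \<delta>"
    using \<epsilon> assms(3) by (auto simp: S_def dist_real_def)
  have dF: "((\<lambda>s. (F s r z)\<^sup>2) has_real_derivative 2 * (F s r z * deriv (\<lambda>s. F s r z) s)) (at s)"
    if "s \<in> I" "r > 0" for s r z
  proof -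
    have "((\<lambda>s. F s r z) has_real_derivative deriv (\<lambda>s. F s r z) s) (at s)"
      using diff[OF that] by (simp add: DERIV_deriv_iff_real_differentiable)
    then show ?thesis by (auto intro!: derivative_eq_intros)
  qed
  let ?E = "\<lambda>s. integral5 (\<lambda>r z. (F s r z)\<^sup>2)"
  have "((\<lambda>s. (?E s - ?E t) / (s - t)) \<longlongrightarrow> 2 * integral\<^sup>L mu5 g) (at t within S)"
    unfolding tendsto_at_iff_sequentially
  proof (intro allI impI)
    fix X assume X: "\<forall>i. X i \<in> S - {t}" "X \<longlonglongrightarrow> t"
    have XS: "X i \<in> S" "X i \<in> I" "X i \<noteq> t" for i using X(1) S(4) by auto
    let ?q = "\<lambda>i p. ((F (X i) (fst p) (snd p))\<^sup>2 - (F t (fst p) (snd p))\<^sup>2) / (X i - t)"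
    have int': "integrable mu5 (\<lambda>p. (F s (fst p) (snd p))\<^sup>2)" if "s \<in> I" for s
      using int[OF that] by (simp add: integrable5_def split_beta')
    have E: "(?E (X i) - ?E t) / (X i - t) = integral\<^sup>L mu5 (?q i)" for i
      using int' XS(2) assms(2) by (simp add: integral5_def split_beta')
    have "(\<lambda>i. integral\<^sup>L mu5 (?q i)) \<longlonglongrightarrow> integral\<^sup>L mu5 (\<lambda>p. 2 * g p)"
    proof (rule integral_dominated_convergence)
      show "integrable mu5 (\<lambda>p. 2 * w (fst p) (snd p))" using w' by simp
      show "AE p in mu5. (\<lambda>i. ?q i p) \<longlonglongrightarrow> 2 * g p"
        using AE_mu5_pos
      proof eventually_elim
        case (elim p)
        have "((\<lambda>s. ((F s (fst p) (snd p))\<^sup>2 - (F t (fst p) (snd p))\<^sup>2) / (s - t)) \<longlongrightarrow> 2 * g p) (at t)"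
          using dF[OF assms(2) elim, of "snd p"] g(2)[OF elim, of "snd p"] by (simp add: has_field_derivative_iff)
        then show ?case
          using X XS unfolding tendsto_at_iff_sequentially comp_def by simp
      qed
      show "AE p in mu5. norm (?q i p) \<le> 2 * w (fst p) (snd p)" for i
        using AE_mu5_pos
      proof eventually_elim
        case (elim p)
        have "norm ((F (X i) (fst p) (snd p))\<^sup>2 - (F t (fst p) (snd p))\<^sup>2) \<le> (2 * w (fst p) (snd p)) * norm (X i - t)"
        proof (rule field_differentiable_bound[OF S(2)])
          fix s assume "s \<in> S"
          then have s: "s \<in> I" "\<bar>s - t\<bar> < \<delta>" using S by auto
          show "((\<lambda>s. (F s (fst p) (snd p))\<^sup>2) has_real_derivative
              2 * (F s (fst p) (snd p) * deriv (\<lambda>s. F s (fst p) (snd p)) s)) (at s within S)"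
            by (rule has_field_derivative_at_within[OF dF[OF s(1) elim]])
          show "norm (2 * (F s (fst p) (snd p) * deriv (\<lambda>s. F s (fst p) (snd p)) s)) \<le> 2 * w (fst p) (snd p)"
            using dom[OF s elim, of "snd p"] by (simp add: abs_mult)
        qed (use XS S in auto)
        then show ?case
          using XS(3)[of i] by (simp add: divide_le_eq)
      qed
      show "?q i \<in> borel_measurable mu5" for i
        using int'[OF XS(2)[of i]] int'[OF assms(2)] by auto
    qed simp
    then show "((\<lambda>s. (?E s - ?E t) / (s - t)) \<circ> X) \<longlonglongrightarrow> 2 * integral\<^sup>L mu5 g"
      by (simp add: comp_def E)
  qed
  then show "(?E has_real_derivative 2 * integral\<^sup>L mu5 g) (at t)"
    by (simp add: has_field_derivative_iff at_within_open[OF S(3,1)])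
qed

section \<open>The three integral identities in space\<close>

text \<open>
  The flux is \<open>b F\<^sup>2\<close>, with divergence \<open>(div b) F\<^sup>2 + 2 F (b \<cdot> \<nabla>F)\<close>. In \<open>div b\<close> the radial component
  contributes \<open>- \<Phi>\<^sub>z - r \<Phi>\<^sub>z\<^sub>r - 3 \<Phi>\<^sub>z\<close> and the vertical one \<open>m \<Phi>\<^sub>z + r \<Phi>\<^sub>r\<^sub>z\<close>; the equality of the
  mixed derivatives leaves \<open>(m - 4) \<Phi>\<^sub>z\<close>.
\<close>

lemma integral5_advection:
  assumes "smooth5 f" "smooth5 \<phi>" and decay: "space_decaying m f \<phi>"
  shows "2 * integral5 (\<lambda>r z. f r z * advect m \<phi> f r z)
    = (4 - m) * integral5 (\<lambda>r z. D_z \<phi> r z * (f r z)\<^sup>2)"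
proof -
  obtain g gr gz grr grz gzz where g: "continuous_on UNIV g" "continuous_on UNIV gr" "continuous_on UNIV gz"
    "\<And>r z. ((\<lambda>r. g (r, z)) has_real_derivative gr (r, z)) (at r)"
    "\<And>r z. ((\<lambda>z. g (r, z)) has_real_derivative gz (r, z)) (at z)"
    and f: "\<And>r z. r > 0 \<Longrightarrow> f r z = g (r, z)" "\<And>r z. r > 0 \<Longrightarrow> D_r f r z = gr (r, z)"
    "\<And>r z. r > 0 \<Longrightarrow> D_z f r z = gz (r, z)"
    by (rule smooth5_planar_extension[OF assms(1)]) blast
  obtain p pr pz prr prz pzz where p: "continuous_on UNIV p" "continuous_on UNIV pr" "continuous_on UNIV pz"
    "continuous_on UNIV prz"
    "\<And>r z. ((\<lambda>z. p (r, z)) has_real_derivative pz (r, z)) (at z)"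
    "\<And>r z. ((\<lambda>z. pr (r, z)) has_real_derivative prz (r, z)) (at z)"
    "\<And>r z. ((\<lambda>r. pz (r, z)) has_real_derivative prz (r, z)) (at r)"
    and \<phi>: "\<And>r z. r > 0 \<Longrightarrow> \<phi> r z = p (r, z)" "\<And>r z. r > 0 \<Longrightarrow> D_r \<phi> r z = pr (r, z)"
    "\<And>r z. r > 0 \<Longrightarrow> D_z \<phi> r z = pz (r, z)"
    by (rule smooth5_planar_extension[OF assms(2)]) blast
  note cont = g(1-3) p(1-4)
  define adv where "adv q = g q * (- fst q * pz q * gr q + (m * p q + fst q * pr q) * gz q)" for q
  have meas: "h \<in> borel_measurable borel" if "continuous_on UNIV h" for h :: "real \<times> real \<Rightarrow> real"
    using that by (rule borel_measurable_continuous_onI)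
  have X: "integrable mu5 (\<lambda>q. pz q * (g q)\<^sup>2)"
      "integral5 (\<lambda>r z. D_z \<phi> r z * (f r z)\<^sup>2) = (LINT q|mu5. pz q * (g q)\<^sup>2)"
    by (rule integrable5_transfer[of "\<lambda>r z. D_z \<phi> r z * (f r z)\<^sup>2"];
      use decay in \<open>auto simp: space_decaying_def f \<phi> intro!: meas continuous_intros cont\<close>)+
  have Y: "integrable mu5 adv" "integral5 (\<lambda>r z. f r z * advect m \<phi> f r z) = integral\<^sup>L mu5 adv"
    unfolding adv_def
    by (rule integrable5_transfer[of "\<lambda>r z. f r z * advect m \<phi> f r z"];
      use decay in \<open>auto simp: space_decaying_def f \<phi> advect_def drift_r_def drift_z_def
        intro!: meas continuous_intros cont\<close>)+
  have flux1: "integrable mu5 (\<lambda>q. p q * (g q)\<^sup>2)"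
    by (rule integrable5_transfer[of "\<lambda>r z. \<phi> r z * (f r z)\<^sup>2"];
      use decay in \<open>auto simp: space_decaying_def f \<phi> intro!: meas continuous_intros cont\<close>)
  have flux2: "integrable mu5 (\<lambda>q. fst q * pr q * (g q)\<^sup>2)"
    by (rule integrable5_transfer[of "\<lambda>r z. r * D_r \<phi> r z * (f r z)\<^sup>2"];
      use decay in \<open>auto simp: space_decaying_def f \<phi> intro!: meas continuous_intros cont\<close>)
  have flux3: "integrable mu5 (\<lambda>q. fst q * pz q * (g q)\<^sup>2)"
    by (rule integrable5_transfer[of "\<lambda>r z. r * D_z \<phi> r z * (f r z)\<^sup>2"];
      use decay in \<open>auto simp: space_decaying_def f \<phi> intro!: meas continuous_intros cont\<close>)
  have "(LINT q|mu5. (m - 4) * (pz q * (g q)\<^sup>2) + 2 * adv q) = 0"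
  proof (rule integral_divergence5_eq_0)
    show "integrable mu5 (\<lambda>q. - (fst q * pz q * (g q)\<^sup>2))"
      using flux3 by simp
    show "integrable mu5 (\<lambda>q. m * (p q * (g q)\<^sup>2) + fst q * pr q * (g q)\<^sup>2)"
      using flux1 flux2 by simp
    show "integrable mu5 (\<lambda>q. (m - 4) * (pz q * (g q)\<^sup>2) + 2 * adv q)"
      using X Y by simp
    show "((\<lambda>r. - (fst (r, z) * pz (r, z) * (g (r, z))\<^sup>2)) has_real_derivative
        (\<lambda>q. - (pz q * (g q)\<^sup>2 + fst q * prz q * (g q)\<^sup>2 + fst q * pz q * (2 * g q * gr q))) (r, z)) (at r)" for r z
      by (auto intro!: derivative_eq_intros g p simp: algebra_simps)
    show "((\<lambda>z. m * (p (r, z) * (g (r, z))\<^sup>2) + fst (r, z) * pr (r, z) * (g (r, z))\<^sup>2) has_real_derivative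
        (\<lambda>q. (m * pz q + fst q * prz q) * (g q)\<^sup>2 + (m * p q + fst q * pr q) * (2 * g q * gz q)) (r, z)) (at z)" for r z
      by (auto intro!: derivative_eq_intros g p simp: algebra_simps)
  qed (auto intro!: continuous_intros cont simp: adv_def field_simps power2_eq_square)
  moreover have "(LINT q|mu5. (m - 4) * (pz q * (g q)\<^sup>2) + 2 * adv q)
      = (m - 4) * (LINT q|mu5. pz q * (g q)\<^sup>2) + 2 * integral\<^sup>L mu5 adv"
    using X Y by simp
  ultimately show ?thesis
    using X(2) Y(2) by (simp add: algebra_simps)
qed

text \<open>
  Integrability of \<open>F \<Delta>\<^sub>5 F\<close> is not among the decay assumptions; it is read off from the equation.
  That requires a representative that is measurable on the whole plane.
\<close>

lemma Lap5_term_measurable: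
  assumes "smooth5 f"
  obtains h :: "real \<times> real \<Rightarrow> real" where "h \<in> borel_measurable borel"
    "\<And>r z. r > 0 \<Longrightarrow> h (r, z) = f r z * Lap5 f r z"
proof -
  obtain g gr gz grr grz gzz where cont: "continuous_on UNIV g" "continuous_on UNIV gr"
      "continuous_on UNIV grr" "continuous_on UNIV gzz"
    and f: "\<And>r z. r > 0 \<Longrightarrow> f r z = g (r, z)" "\<And>r z. r > 0 \<Longrightarrow> D_r f r z = gr (r, z)"
    "\<And>r z. r > 0 \<Longrightarrow> D_r (D_r f) r z = grr (r, z)" "\<And>r z. r > 0 \<Longrightarrow> D_z (D_z f) r z = gzz (r, z)"
    by (rule smooth5_planar_extension[OF assms]) blast
  have [measurable]: "fst \<in> borel_measurable (borel :: (real \<times> real) measure)"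
      "g \<in> borel_measurable borel" "gr \<in> borel_measurable borel"
      "grr \<in> borel_measurable borel" "gzz \<in> borel_measurable borel"
    using cont by (auto intro!: borel_measurable_continuous_onI continuous_intros)
  show ?thesis
  proof (rule that)
    show "(\<lambda>q. g q * (grr q + 3 / fst q * gr q + gzz q)) \<in> borel_measurable borel"
      by measurable
  qed (simp add: f Lap5_def)
qed

text \<open>
  The flux is \<open>F \<nabla>F\<close>; it is integrable because \<open>F\<close> and \<open>\<nabla>F\<close> are square integrable.
\<close>

lemma integral5_dissipation:
  assumes "smooth5 f"
    and "integrable5 (\<lambda>r z. (f r z)\<^sup>2)" "integrable5 (\<lambda>r z. (D_r f r z)\<^sup>2)" "integrable5 (\<lambda>r z. (D_z f r z)\<^sup>2)"
    and h: "integrable mu5 h" "\<And>r z. r > 0 \<Longrightarrow> h (r, z) = f r z * Lap5 f r z"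
  shows "integral\<^sup>L mu5 h = - (L2norm_grad5 f)\<^sup>2"
proof -
  obtain g gr gz grr grz gzz where cont: "continuous_on UNIV g" "continuous_on UNIV gr" "continuous_on UNIV gz"
      "continuous_on UNIV grr" "continuous_on UNIV gzz"
    and g: "\<And>r z. ((\<lambda>r. g (r, z)) has_real_derivative gr (r, z)) (at r)"
    "\<And>r z. ((\<lambda>z. g (r, z)) has_real_derivative gz (r, z)) (at z)"
    "\<And>r z. ((\<lambda>r. gr (r, z)) has_real_derivative grr (r, z)) (at r)"
    "\<And>r z. ((\<lambda>z. gz (r, z)) has_real_derivative gzz (r, z)) (at z)"
    and f: "\<And>r z. r > 0 \<Longrightarrow> f r z = g (r, z)" "\<And>r z. r > 0 \<Longrightarrow> D_r f r z = gr (r, z)"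
    "\<And>r z. r > 0 \<Longrightarrow> D_z f r z = gz (r, z)"
    "\<And>r z. r > 0 \<Longrightarrow> D_r (D_r f) r z = grr (r, z)" "\<And>r z. r > 0 \<Longrightarrow> D_z (D_z f) r z = gzz (r, z)"
    by (rule smooth5_planar_extension[OF assms(1)]) blast
  have meas: "h \<in> borel_measurable borel" if "continuous_on UNIV h" for h :: "real \<times> real \<Rightarrow> real"
    using that by (rule borel_measurable_continuous_onI)
  have sq: "integrable mu5 (\<lambda>q. (g q)\<^sup>2)" "integrable mu5 (\<lambda>q. (gr q)\<^sup>2)" "integrable mu5 (\<lambda>q. (gz q)\<^sup>2)"
    by (rule integrable5_transfer[OF assms(2)] integrable5_transfer[OF assms(3)] integrable5_transfer[OF assms(4)];
      auto simp: f intro!: meas continuous_intros cont)+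
  have prod: "integrable mu5 (\<lambda>q. a q * b q)"
    if "continuous_on UNIV a" "continuous_on UNIV b" "integrable mu5 (\<lambda>q. (a q)\<^sup>2)" "integrable mu5 (\<lambda>q. (b q)\<^sup>2)"
    for a b :: "real \<times> real \<Rightarrow> real"
  proof (rule Bochner_Integration.integrable_bound)
    show "integrable mu5 (\<lambda>q. (a q)\<^sup>2 + (b q)\<^sup>2)" using that by simp
    have "\<bar>x * y\<bar> \<le> x\<^sup>2 + y\<^sup>2" for x y :: real
    proof -
      have "0 \<le> \<bar>x\<bar> * \<bar>y\<bar>" "2 * (\<bar>x\<bar> * \<bar>y\<bar>) \<le> x\<^sup>2 + y\<^sup>2"
        using sum_squares_bound[of "\<bar>x\<bar>" "\<bar>y\<bar>"] by simp_all
      then show ?thesis unfolding abs_mult by linarith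
    qed
    then show "AE q in mu5. norm (a q * b q) \<le> norm ((a q)\<^sup>2 + (b q)\<^sup>2)" by simp
    show "(\<lambda>q. a q * b q) \<in> borel_measurable mu5"
      using meas[OF continuous_on_mult[OF that(1,2)]] by (simp cong: measurable_cong_sets)
  qed
  have "integrable5 (\<lambda>r z. (norm (D_r f r z, D_z f r z))\<^sup>2)"
    using assms(3,4) by (simp add: integrable5_def norm_Pair split_beta')
  then have grad: "integral5 (\<lambda>r z. (norm (D_r f r z, D_z f r z))\<^sup>2) = (LINT q|mu5. (gr q)\<^sup>2 + (gz q)\<^sup>2)"
    by (rule integrable5_transfer) (auto simp: f norm_Pair intro!: meas continuous_intros cont)
  have "(LINT q|mu5. h q + ((gr q)\<^sup>2 + (gz q)\<^sup>2)) = 0"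
  proof (rule integral_divergence5_eq_0)
    show "integrable mu5 (\<lambda>q. g q * gr q)" "integrable mu5 (\<lambda>q. g q * gz q)"
      using cont sq by (auto intro: prod)
    show "integrable mu5 (\<lambda>q. h q + ((gr q)\<^sup>2 + (gz q)\<^sup>2))"
      using sq h by simp
    show "((\<lambda>r. g (r, z) * gr (r, z)) has_real_derivative (\<lambda>q. (gr q)\<^sup>2 + g q * grr q) (r, z)) (at r)"
         "((\<lambda>z. g (r, z) * gz (r, z)) has_real_derivative (\<lambda>q. (gz q)\<^sup>2 + g q * gzz q) (r, z)) (at z)" for r z
      by (auto intro!: derivative_eq_intros g simp: power2_eq_square)
  qed (auto intro!: continuous_intros cont simp: h f Lap5_def algebra_simps)
  moreover have "(L2norm_grad5 f)\<^sup>2 = (LINT q|mu5. (gr q)\<^sup>2 + (gz q)\<^sup>2)"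
    by (simp add: L2norm_grad5_def L2norm5_def grad)
  ultimately show ?thesis
    using sq h by simp
qed

text \<open>
  The vertical flux \<open>\<Phi> F\<^sup>2\<close> moves the \<open>z\<close>-derivative in \<open>S = \<partial>\<^sub>z(F\<^sup>2)\<close> onto \<open>\<Phi>\<close>.
\<close>

lemma integral5_source_pairing:
  assumes "smooth5 f" "smooth5 \<phi>"
    and "integrable5 (\<lambda>r z. \<phi> r z * (f r z)\<^sup>2)" "integrable5 (\<lambda>r z. D_z \<phi> r z * (f r z)\<^sup>2)"
    and h: "integrable mu5 h" "\<And>r z. r > 0 \<Longrightarrow> h (r, z) = \<phi> r z * source f r z"
  shows "integral\<^sup>L mu5 h = - integral5 (\<lambda>r z. D_z \<phi> r z * (f r z)\<^sup>2)"
proof -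
  obtain g gr gz grr grz gzz where g: "continuous_on UNIV g" "continuous_on UNIV gz"
    "\<And>r z. ((\<lambda>z. g (r, z)) has_real_derivative gz (r, z)) (at z)"
    and f: "\<And>r z. r > 0 \<Longrightarrow> f r z = g (r, z)"
    by (rule smooth5_planar_extension[OF assms(1)]) blast
  obtain p pr pz prr prz pzz where p: "continuous_on UNIV p" "continuous_on UNIV pz"
    "\<And>r z. ((\<lambda>z. p (r, z)) has_real_derivative pz (r, z)) (at z)"
    and \<phi>: "\<And>r z. r > 0 \<Longrightarrow> \<phi> r z = p (r, z)" "\<And>r z. r > 0 \<Longrightarrow> D_z \<phi> r z = pz (r, z)"
    by (rule smooth5_planar_extension[OF assms(2)]) blast
  note cont = g(1,2) p(1,2)
  have meas: "h \<in> borel_measurable borel" if "continuous_on UNIV h" for h :: "real \<times> real \<Rightarrow> real"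
    using that by (rule borel_measurable_continuous_onI)
  have S: "source f r z = 2 * g (r, z) * gz (r, z)" if "r > 0" for r z
    unfolding source_def
    by (rule D_z_eqI[of _ _ "\<lambda>z. (g (r, z))\<^sup>2"]) (use that in \<open>auto simp: f intro!: derivative_eq_intros g\<close>)
  have X: "integrable mu5 (\<lambda>q. pz q * (g q)\<^sup>2)"
      "integral5 (\<lambda>r z. D_z \<phi> r z * (f r z)\<^sup>2) = (LINT q|mu5. pz q * (g q)\<^sup>2)"
    by (rule integrable5_transfer[OF assms(4)]; auto simp: f \<phi> intro!: meas continuous_intros cont)+
  have flux: "integrable mu5 (\<lambda>q. p q * (g q)\<^sup>2)"
    by (rule integrable5_transfer[OF assms(3)]) (auto simp: f \<phi> intro!: meas continuous_intros cont)
  have "(LINT q|mu5. pz q * (g q)\<^sup>2 + h q) = 0"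
  proof (rule integral_divergence5_eq_0)
    show "integrable mu5 (\<lambda>q. 0 :: real)" by simp
    show "integrable mu5 (\<lambda>q. p q * (g q)\<^sup>2)" by (rule flux)
    show "integrable mu5 (\<lambda>q. pz q * (g q)\<^sup>2 + h q)"
      using X h by simp
    show "((\<lambda>r. 0) has_real_derivative (\<lambda>q. 0) (r, z)) (at r)" for r z :: real
      by simp
    show "((\<lambda>z. p (r, z) * (g (r, z))\<^sup>2) has_real_derivative
        (\<lambda>q. pz q * (g q)\<^sup>2 + p q * (2 * g q * gz q)) (r, z)) (at z)" for r z
      by (auto intro!: derivative_eq_intros g p simp: algebra_simps)
  qed (auto intro!: continuous_intros cont simp: h f \<phi> S algebra_simps)
  then show ?thesis
    using X h by simp
qed

section \<open>The energy identity\<close>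

theorem theorem5p2:
  fixes \<nu> m \<kappa> \<beta> :: real
    and I :: "real set"
    and F \<Phi> G P :: "real \<Rightarrow> real \<Rightarrow> real \<Rightarrow> real"
  assumes "\<nu> > 0" and "\<beta> > 0"
    and "open I" and "is_interval I"
    and "smooth_decaying m I F \<Phi>"
    and "solves \<nu> m I F \<Phi>"
    and "\<And>t. t \<in> I \<Longrightarrow> has_A_power (- \<beta>) (source (F t)) (G t)"
    and "\<And>t r z. t \<in> I \<Longrightarrow> r > 0 \<Longrightarrow> \<Phi> t r z = - \<kappa> * G t r z"
    and "\<And>t. t \<in> I \<Longrightarrow> has_A_power (- \<beta> / 2) (source (F t)) (P t)"
    and "\<And>t. t \<in> I \<Longrightarrow> integrable5 (\<lambda>r z. (P t r z)\<^sup>2)"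
    and "\<And>t. t \<in> I \<Longrightarrow> integrable5 (\<lambda>r z. G t r z * source (F t) r z)"
    and "\<And>t. t \<in> I \<Longrightarrow>
           integral5 (\<lambda>r z. G t r z * source (F t) r z) = (L2norm5 (P t))\<^sup>2"
  shows "\<forall>t\<in>I.
     (\<lambda>s. (L2norm5 (F s))\<^sup>2) differentiable (at t) \<and>
     1 / 2 * deriv (\<lambda>s. (L2norm5 (F s))\<^sup>2) t + \<nu> * (L2norm_grad5 (F t))\<^sup>2
       = m * \<kappa> / 2 * (L2norm5 (P t))\<^sup>2"
proof
  fix t assume t: "t \<in> I"
  let ?X = "integral5 (\<lambda>r z. D_z (\<Phi> t) r z * (F t r z)\<^sup>2)"
  have smooth: "smooth5 (F t)" "smooth5 (\<Phi> t)" and decay: "space_decaying m (F t) (\<Phi> t)"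
    using assms(5) t by (auto simp: smooth_decaying_def)
  note decay' = decay[unfolded space_decaying_def]
  have diff: "(\<lambda>s. F s r z) differentiable (at s)" if "s \<in> I" "r > 0" for s r z
    using assms(6) that by (simp add: solves_def)
  have pde: "deriv (\<lambda>s. F s r z) t
      = \<nu> * Lap5 (F t) r z + 2 * D_z (\<Phi> t) r z * F t r z - advect m (\<Phi> t) (F t) r z" if "r > 0" for r z
  proof -
    have "deriv (\<lambda>s. F s r z) t + advect m (\<Phi> t) (F t) r z
        = \<nu> * Lap5 (F t) r z + 2 * D_z (\<Phi> t) r z * F t r z"
      using assms(6) t that unfolding solves_def by blast
    then show ?thesis by linarith
  qed
  obtain \<delta> w where w: "\<delta> > 0" "integrable5 w"
    "\<And>s r z. s \<in> I \<Longrightarrow> \<bar>s - t\<bar> < \<delta> \<Longrightarrow> r > 0 \<Longrightarrow> \<bar>F s r z * deriv (\<lambda>s. F s r z) s\<bar> \<le> w r z"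
    using assms(5) t unfolding smooth_decaying_def time_dominated_def by metis

  \<comment> \<open>\<open>d\<close>, \<open>x\<close>, \<open>a\<close> and \<open>g\<close> represent \<open>F \<Delta>\<^sub>5 F\<close>, \<open>\<Phi>\<^sub>z F\<^sup>2\<close>, \<open>F (b \<cdot> \<nabla>F)\<close> and \<open>F F\<^sub>t\<close> on \<open>r > 0\<close>.\<close>
  obtain d where d: "d \<in> borel_measurable borel" "\<And>r z. r > 0 \<Longrightarrow> d (r, z) = F t r z * Lap5 (F t) r z"
    using Lap5_term_measurable[OF smooth(1)] by blast
  define x where "x q = D_z (\<Phi> t) (fst q) (snd q) * (F t (fst q) (snd q))\<^sup>2" for q
  define a where "a q = F t (fst q) (snd q) * advect m (\<Phi> t) (F t) (fst q) (snd q)" for q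
  have x: "integrable mu5 x" "integral\<^sup>L mu5 x = ?X"
    using decay' unfolding x_def by (simp_all add: integrable5_def integral5_def split_beta')
  have a: "integrable mu5 a" "2 * integral\<^sup>L mu5 a = (4 - m) * ?X"
    using decay' integral5_advection[OF smooth decay]
    unfolding a_def by (simp_all add: integrable5_def integral5_def split_beta')
  define g where "g q = \<nu> * d q + 2 * x q - a q" for q
  have g: "g (r, z) = F t r z * deriv (\<lambda>s. F s r z) t" if "r > 0" for r z
    using that by (simp add: g_def x_def a_def d pde algebra_simps power2_eq_square)
  have "g \<in> borel_measurable borel"
    using borel_measurable_integrable[OF x(1)] borel_measurable_integrable[OF a(1)] d(1)
    unfolding g_def by (auto cong: measurable_cong_sets)
  moreover have "integrable5 (\<lambda>r z. (F s r z)\<^sup>2)" if "s \<in> I" for s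
    using assms(5) that by (simp add: smooth_decaying_def space_decaying_def)
  ultimately have int_g: "integrable mu5 g"
    and E: "((\<lambda>s. integral5 (\<lambda>r z. (F s r z)\<^sup>2)) has_real_derivative 2 * integral\<^sup>L mu5 g) (at t)"
    using has_derivative_integral5_square[OF assms(3) t w(1) diff w(2,3), of g] g by blast+

  \<comment> \<open>The viscous term is \<open>F F\<^sub>t\<close> plus cubic terms, divided by \<open>\<nu> > 0\<close>; hence it is integrable.\<close>
  have "integrable mu5 (\<lambda>q. (g q + a q - 2 * x q) / \<nu>)"
    using int_g a x by simp
  then have int_d: "integrable mu5 d"
    using assms(1) by (simp add: g_def)
  have "integral\<^sup>L mu5 d = - (L2norm_grad5 (F t))\<^sup>2"
    using decay' by (intro integral5_dissipation smooth int_d d) auto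
  moreover have "integral\<^sup>L mu5 g = \<nu> * integral\<^sup>L mu5 d + 2 * integral\<^sup>L mu5 x - integral\<^sup>L mu5 a"
    unfolding g_def using int_d x a by simp
  ultimately have int_g_eq: "integral\<^sup>L mu5 g = - \<nu> * (L2norm_grad5 (F t))\<^sup>2 + m / 2 * ?X"
    using x(2) a(2) by (simp add: field_simps)

  \<comment> \<open>The nonlocal relation enters here: \<open>\<Phi> S = - \<kappa> G S\<close>, and the pairing of \<open>G\<close> with \<open>S\<close> is known.\<close>
  have "integrable mu5 (\<lambda>q. G t (fst q) (snd q) * source (F t) (fst q) (snd q))"
    using assms(11)[OF t] by (simp add: integrable5_def split_beta')
  then have "(LINT q|mu5. - \<kappa> * (G t (fst q) (snd q) * source (F t) (fst q) (snd q))) = - ?X"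
    using decay' assms(8)[OF t] by (intro integral5_source_pairing smooth) auto
  then have X: "?X = \<kappa> * (L2norm5 (P t))\<^sup>2"
    using assms(12)[OF t] by (simp add: integral5_def split_beta')

  have "(L2norm5 (F s))\<^sup>2 = integral5 (\<lambda>r z. (F s r z)\<^sup>2)" for s
    by (auto simp: L2norm5_def integral5_def split_beta' intro!: Bochner_Integration.integral_nonneg)
  then have E': "((\<lambda>s. (L2norm5 (F s))\<^sup>2) has_real_derivative 2 * integral\<^sup>L mu5 g) (at t)"
    using E by simp
  then show "(\<lambda>s. (L2norm5 (F s))\<^sup>2) differentiable (at t) \<and>
     1 / 2 * deriv (\<lambda>s. (L2norm5 (F s))\<^sup>2) t + \<nu> * (L2norm_grad5 (F t))\<^sup>2
       = m * \<kappa> / 2 * (L2norm5 (P t))\<^sup>2"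
    unfolding DERIV_imp_deriv[OF E'] real_differentiable_def
    by (auto simp: int_g_eq X algebra_simps)
qed

end
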